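(* Let $s\ge 1$ and $r\ge 0$ be integers. Let $H$ be an $s$-critical graph with vertices $v_1,\dots,v_q$ (so $q=|V(H)|$), and let $L_1,\dots,L_q$ be $(r+1)$-critical graphs (taken vertex-disjoint from each other and from $H$). Choose a vertex $w_i\in V(L_i)$ for each $i\in\{1,\dots,q\}$, and let $G$ be the graph formed from the disjoint union of $H,L_1,\dots,L_q$ by identifying $v_i$ with $w_i$ for every $i\in\{1,\dots,q\}$. If $H$ and all of the graphs $L_i$, $i\in\{1,\dots,q\}$, are $1$-unique, then $G$ is $1$-unique and $(r+s)$-critical. Furthermore, if $|V(H)|\le 2^{\mathrm{td}(H)-1}$ and $|V(L_i)|\le 2^{\mathrm{td}(L_i)-1}$ for each $i$, then $|V(G)|\le 2^{\mathrm{td}(G)-1}$.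
   Context: Graphs are finite and simple. A $k$-ranking of a graph $G$ is a labeling of $V(G)$ with values from $\{1,\dots,k\}$ such that every path joining two distinct vertices with the same label contains a vertex having a larger label. The tree-depth $\mathrm{td}(G)$ is the smallest $k$ for which $G$ has a $k$-ranking (the graph with no vertices has tree-depth $0$). A ranking of $G$ is optimal if it is a $\mathrm{td}(G)$-ranking. A graph is $k$-critical if it has tree-depth $k$ and every proper minor of it has tree-depth less than $k$. A graph $G$ is $1$-unique if for every vertex $v$ of $G$ there is an optimal ranking of $G$ in which $v$ is the only vertex receiving label $1$. *)

theory Defs
  imports "Graph_Theory.Graph_Theory"
begin

text \<open>
  Finite simple graphs are the graphs of the locale \<^locale>\<open>pair_graph\<close>: finite, loop-free,
  symmetric digraphs without parallel arcs, an edge \<open>uv\<close> being the two arcs \<open>(u, v)\<close> and \<open>(v, u)\<close>.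
  The null graph is allowed.
\<close>

definition is_ranking :: "nat \<Rightarrow> 'a pair_pre_digraph \<Rightarrow> ('a \<Rightarrow> nat) \<Rightarrow> bool" where
  "is_ranking k G f \<longleftrightarrow>
     (\<forall>v \<in> pverts G. f v \<in> {1..k}) \<and>
     (\<forall>p. vpath p (with_proj G) \<and> hd p \<noteq> last p \<and> f (hd p) = f (last p) \<longrightarrow>
          (\<exists>x \<in> set p. f x > f (hd p)))"

definition tree_depth :: "'a pair_pre_digraph \<Rightarrow> nat" where
  "tree_depth G = (LEAST k. \<exists>f. is_ranking k G f)"

definition optimal_ranking :: "'a pair_pre_digraph \<Rightarrow> ('a \<Rightarrow> nat) \<Rightarrow> bool" where
  "optimal_ranking G f \<longleftrightarrow> is_ranking (tree_depth G) G f"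

definition one_unique :: "'a pair_pre_digraph \<Rightarrow> bool" where
  "one_unique G \<longleftrightarrow>
     (\<forall>v \<in> pverts G. \<exists>f. optimal_ranking G f \<and> {u \<in> pverts G. f u = 1} = {v})"

text \<open>
  The simple graph obtained by identifying vertices with the same image under \<open>f\<close>: parallel
  edges merge since arcs form a set, and loops are discarded.
\<close>

definition identify_verts :: "('a \<Rightarrow> 'b) \<Rightarrow> 'a pair_pre_digraph \<Rightarrow> 'b pair_pre_digraph" where
  "identify_verts f G =
     \<lparr> pverts = f ` pverts G, parcs = map_prod f f ` parcs G - Id \<rparr>"

text \<open>
  In a contraction of the edge \<open>uv\<close> the merged vertex keeps the name \<open>u\<close>, so every minor has, up to
  isomorphism, a representative on the same vertex type. As each operation decreases the number of
  vertices or edges and increases neither, the proper minors are those reached by at least one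
  operation.
\<close>

inductive minor_step :: "'a pair_pre_digraph \<Rightarrow> 'a pair_pre_digraph \<Rightarrow> bool" where
  del_vertex: "v \<in> pverts G \<Longrightarrow>
     minor_step G \<lparr> pverts = pverts G - {v},
                    parcs = {(x, y) \<in> parcs G. x \<noteq> v \<and> y \<noteq> v} \<rparr>"
| del_edge: "(u, v) \<in> parcs G \<Longrightarrow>
     minor_step G \<lparr> pverts = pverts G, parcs = parcs G - {(u, v), (v, u)} \<rparr>"
| contract_edge: "(u, v) \<in> parcs G \<Longrightarrow>
     minor_step G (identify_verts (\<lambda>x. if x = v then u else x) G)"

definition proper_minor :: "'a pair_pre_digraph \<Rightarrow> 'a pair_pre_digraph \<Rightarrow> bool" where
  "proper_minor M G \<longleftrightarrow> minor_step\<^sup>+\<^sup>+ G M"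

definition critical :: "nat \<Rightarrow> 'a pair_pre_digraph \<Rightarrow> bool" where
  "critical k G \<longleftrightarrow> tree_depth G = k \<and> (\<forall>M. proper_minor M G \<longrightarrow> tree_depth M < k)"

text \<open>
  The disjoint union of \<open>H\<close> and \<open>L 1, \<dots>, L q\<close>; the tags make the graphs vertex-disjoint, whatever
  their vertices are.
\<close>

definition disjoint_union ::
    "'a pair_pre_digraph \<Rightarrow> nat \<Rightarrow> (nat \<Rightarrow> 'b pair_pre_digraph) \<Rightarrow>
     ('a + nat \<times> 'b) pair_pre_digraph" where
  "disjoint_union H q L =
     \<lparr> pverts = Inl ` pverts H \<union> {Inr (i, x) | i x. i \<in> {1..q} \<and> x \<in> pverts (L i)},
       parcs = {(Inl x, Inl y) | x y. (x, y) \<in> parcs H} \<union>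
               {(Inr (i, x), Inr (i, y)) | i x y. i \<in> {1..q} \<and> (x, y) \<in> parcs (L i)} \<rparr>"

text \<open>
  The vertex resulting from the identification of \<open>v i\<close> with \<open>w i\<close> is represented by \<open>Inl (v i)\<close>.
\<close>

definition glue ::
    "'a pair_pre_digraph \<Rightarrow> nat \<Rightarrow> (nat \<Rightarrow> 'a) \<Rightarrow> (nat \<Rightarrow> 'b pair_pre_digraph) \<Rightarrow> (nat \<Rightarrow> 'b) \<Rightarrow>
     ('a + nat \<times> 'b) pair_pre_digraph" where
  "glue H q v L w =
     identify_verts
       (\<lambda>z. case z of Inl a \<Rightarrow> Inl a
                    | Inr (i, x) \<Rightarrow> if x = w i then Inl (v i) else Inr (i, x))
       (disjoint_union H q L)"

end

theory Submission
  imports Defs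
begin

text \<open>
  Call \<open>H\<close> the core and the graphs \<open>L i\<close> the bags of \<open>G\<close>; the root \<open>w i\<close> of a bag is the core
  vertex \<open>v i\<close>.

  Lower bound: critical graphs are connected, and each bag has a label above \<open>r\<close> in every ranking
  of \<open>G\<close>. The largest labels of the bags, lowered by \<open>r\<close>, rank the core, so \<open>G\<close> has tree-depth
  at least \<open>r + s\<close> (\<open>ranks_rooted_bound\<close>). The bound on the number of vertices follows from this
  by multiplying the bounds for the core and the bags.

  Upper bounds: rankings of \<open>G\<close> are assembled from rankings of the parts (\<open>ranks_rooted\<close>). If the
  root is the only vertex of label 1 in a ranking of its bag, the other vertices of the bag need
  only \<open>r\<close> labels, and the roots can be labelled from above by a ranking of the core. If, in
  addition, one core vertex is the only core vertex of label 1, its bag can be labelled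
  independently as a whole, and the remaining roots need only \<open>s - 1\<close> further labels. With all
  \<open>r + 1\<close> labels in this special bag one gets rankings of \<open>G\<close> with \<open>r + s\<close> labels and a prescribed
  single vertex of label 1 (\<open>ranks_unique\<close>). This is 1-uniqueness, and it makes every vertex deletion
  lower the tree-depth, since the vertex can be removed along with its label. Deleting or contracting
  an edge saves a label in the core or in one bag, and the same two constructions turn this into a
  saving for \<open>G\<close> (\<open>ranks_core\<close>, \<open>ranks_bag\<close>).
\<close>

section \<open>Rankings without paths\<close>

definition below :: "'a rel \<Rightarrow> ('a \<Rightarrow> nat) \<Rightarrow> nat \<Rightarrow> 'a rel" where
  "below E g m = Restr E {z. g z \<le> m}"

text \<open>
  The arcs in \<open>D\<close> stand for contracted edges: instead of building the contracted graph, the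
  vertices of the graph are kept, the two ends of a contracted edge get the same label, and this is
  the only coincidence of labels within a component of \<open>below\<close> that is tolerated. With
  \<open>D = {}\<close> this is an ordinary ranking, with \<open>D = edge u v\<close> a ranking of the contraction of
  \<open>uv\<close>. Thus a graph, its edge deletions and its contractions live on one vertex set. A path without
  labels above \<open>m\<close> is replaced by reachability in \<open>below E g m\<close>, which composes and maps more
  easily than vertex lists.
\<close>

definition ranks :: "nat \<Rightarrow> 'a set \<Rightarrow> 'a rel \<Rightarrow> 'a rel \<Rightarrow> ('a \<Rightarrow> nat) \<Rightarrow> bool" where
  "ranks k V E D g \<longleftrightarrow>
     (\<forall>x \<in> V. g x \<in> {1..k}) \<and>
     (\<forall>(x, y) \<in> D. g x = g y) \<and>
     (\<forall>x \<in> V. \<forall>y \<in> V. g x = g y \<longrightarrow> (x, y) \<in> (below E g (g x))\<^sup>* \<longrightarrow> x = y \<or> (x, y) \<in> D)"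

abbreviation edge :: "'a \<Rightarrow> 'a \<Rightarrow> 'a rel" where
  "edge u v \<equiv> {(u, v), (v, u)}"

lemma below_iff: "(x, y) \<in> below E g m \<longleftrightarrow> (x, y) \<in> E \<and> g x \<le> m \<and> g y \<le> m"
  by (auto simp: below_def)

lemma ranksI:
  assumes "\<And>x. x \<in> V \<Longrightarrow> 1 \<le> g x \<and> g x \<le> k"
    and "\<And>x y. (x, y) \<in> D \<Longrightarrow> g x = g y"
    and "\<And>x y. \<lbrakk>x \<in> V; y \<in> V; g x = g y; (x, y) \<in> (below E g (g x))\<^sup>*\<rbrakk> \<Longrightarrow> x = y \<or> (x, y) \<in> D"
  shows "ranks k V E D g"
  using assms unfolding ranks_def by auto

lemma ranksD:
  assumes "ranks k V E D g"
  shows "x \<in> V \<Longrightarrow> 1 \<le> g x" and "x \<in> V \<Longrightarrow> g x \<le> k"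
    and "(x, y) \<in> D \<Longrightarrow> g x = g y"
    and "\<lbrakk>x \<in> V; y \<in> V; g x = g y; (x, y) \<in> (below E g (g x))\<^sup>*\<rbrakk> \<Longrightarrow> x = y \<or> (x, y) \<in> D"
  using assms unfolding ranks_def by auto

lemma ranks_le: "ranks k V E D g \<Longrightarrow> k \<le> k' \<Longrightarrow> ranks k' V E D g"
  unfolding ranks_def by fastforce

lemma rtrancl_transfer:
  assumes "(x, y) \<in> R\<^sup>*" and "\<And>a b. (a, b) \<in> R \<Longrightarrow> (f a, f b) \<in> S\<^sup>*"
  shows "(f x, f y) \<in> S\<^sup>*"
  using assms(1) by induction (auto intro: rtrancl_trans assms(2))

text \<open>
  Restriction to subgraphs and transport along isomorphisms are both instances: a homomorphism maps
  the components of low label into components of low label, and injectivity carries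
  distinctness of vertices along.
\<close>

lemma ranks_pullback:
  assumes "ranks k V' E' D' g"
    and inj: "inj_on \<phi> V" and verts: "\<And>x. x \<in> V \<Longrightarrow> \<phi> x \<in> V'"
    and arcs: "\<And>x y. (x, y) \<in> E \<Longrightarrow> (\<phi> x, \<phi> y) \<in> E'"
    and D1: "\<And>x y. (x, y) \<in> D \<Longrightarrow> (\<phi> x, \<phi> y) \<in> D'"
    and D2: "\<And>x y. \<lbrakk>x \<in> V; y \<in> V; (\<phi> x, \<phi> y) \<in> D'\<rbrakk> \<Longrightarrow> (x, y) \<in> D"
  shows "ranks k V E D (\<lambda>x. g (\<phi> x))"
proof (rule ranksI)
  fix x y
  assume xy: "x \<in> V" "y \<in> V" "g (\<phi> x) = g (\<phi> y)"
    and reach: "(x, y) \<in> (below E (\<lambda>x. g (\<phi> x)) (g (\<phi> x)))\<^sup>*"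
  have "(\<phi> x, \<phi> y) \<in> (below E' g (g (\<phi> x)))\<^sup>*"
    by (rule rtrancl_transfer[OF reach]) (auto simp: below_iff arcs)
  then have "\<phi> x = \<phi> y \<or> (\<phi> x, \<phi> y) \<in> D'"
    using ranksD(4)[OF assms(1)] xy verts by blast
  then show "x = y \<or> (x, y) \<in> D"
    using D2 xy inj by (auto dest: inj_onD)
qed (use ranksD[OF assms(1)] verts D1 in auto)

corollary ranks_subgraph:
  assumes "ranks k V' E' {} g" "V \<subseteq> V'" "E \<subseteq> E'"
  shows "ranks k V E {} g"
  by (rule ranks_pullback[OF assms(1), where \<phi> = "\<lambda>x. x"]) (use assms(2,3) in auto)

text \<open>
  Every walk can be shortened to a path on a subset of its vertices, so paths and reachability
  see the same obstructions.
\<close>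

lemma is_ranking_iff_ranks:
  assumes "pair_wf_digraph G"
  shows "is_ranking k G f \<longleftrightarrow> ranks k (pverts G) (parcs G) {} f"
proof
  interpret pair_wf_digraph G by fact
  assume f: "is_ranking k G f"
  show "ranks k (pverts G) (parcs G) {} f"
  proof (rule ranksI)
    fix x y
    assume xy: "x \<in> pverts G" "y \<in> pverts G" "f x = f y"
      and reach: "(x, y) \<in> (below (parcs G) f (f x))\<^sup>*"
    define m where "m = f x"
    have "(x, y) \<in> (below (parcs G) f m)\<^sup>*" using reach by (simp add: m_def)
    then have "\<exists>p. vwalk p (with_proj G) \<and> hd p = x \<and> last p = y \<and> (\<forall>z \<in> set p. f z \<le> m)"
    proof (induction rule: converse_rtrancl_induct)
      case base
      then show ?case using xy by (intro exI[of _ "[y]"]) (auto simp: m_def vwalk_def)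
    next
      case (step a b)
      then obtain p where p: "vwalk p (with_proj G)" "hd p = b" "last p = y" "\<forall>z \<in> set p. f z \<le> m"
        by blast
      have "vwalk (a # p) (with_proj G)"
        using p step(1) by (intro vwalk_consI) (auto simp: below_iff dest: in_arcsD1)
      then show ?case
        using p step(1) by (intro exI[of _ "a # p"]) (auto simp: below_iff)
    qed
    then obtain p where p: "vwalk p (with_proj G)" "hd p = x" "last p = y" "\<forall>z \<in> set p. f z \<le> m"
      by blast
    let ?q = "vwalk_to_vpath p"
    have "vpath ?q (with_proj G)" "hd ?q = x" "last ?q = y" "\<forall>z \<in> set ?q. f z \<le> m"
      using p by (auto simp: vwalk_to_vpath_vpath vwalk_to_vpath_hd vwalk_to_vpath_last
          dest: vwalk_to_vpath_subset)
    with f xy(3) show "x = y \<or> (x, y) \<in> {}"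
      unfolding is_ranking_def m_def by (metis not_le)
  qed (use f in \<open>auto simp: is_ranking_def\<close>)
next
  assume f: "ranks k (pverts G) (parcs G) {} f"
  have "\<exists>x \<in> set p. f x > f (hd p)"
    if p: "vpath p (with_proj G)" "hd p \<noteq> last p" "f (hd p) = f (last p)" for p
  proof (rule ccontr)
    assume "\<not> ?thesis"
    then have low: "\<forall>x \<in> set p. f x \<le> f (hd p)" by auto
    have reach: "(hd p, last p) \<in> (below (parcs G) f m)\<^sup>*"
      if "vwalk p (with_proj G)" "\<forall>x \<in> set p. f x \<le> m" for m
      using that
    proof (induction p rule: list.induct)
      case (Cons u q)
      show ?case
      proof (cases q)
        case (Cons b q')
        have "(u, b) \<in> below (parcs G) f m"
          using Cons.prems Cons by (auto simp: below_iff vwalk_def)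
        moreover have "(b, last q) \<in> (below (parcs G) f m)\<^sup>*"
          using Cons.IH Cons.prems Cons by (auto simp: vwalk_def)
        ultimately show ?thesis using Cons by (auto intro: converse_rtrancl_into_rtrancl)
      qed auto
    qed (auto simp: vwalk_def)
    have "hd p \<in> pverts G" "last p \<in> pverts G"
      using p(1) by (auto simp: vpath_def vwalk_def)
    with reach[OF _ low] p ranksD(4)[OF f, of "hd p" "last p"] show False
      by (auto simp: vpath_def)
  qed
  with f show "is_ranking k G f" by (auto simp: is_ranking_def ranks_def)
qed

lemma pair_graph_wf: "pair_graph G \<Longrightarrow> pair_wf_digraph G"
  by (simp add: pair_graph_def pair_digraph_def pair_fin_digraph_def)

lemma pair_graph_iff:
  "pair_graph G \<longleftrightarrow> finite (pverts G) \<and> parcs G \<subseteq> pverts G \<times> pverts G \<and> sym (parcs G) \<and>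
     (\<forall>x. (x, x) \<notin> parcs G)"
proof -
  have "finite (pverts G) \<and> parcs G \<subseteq> pverts G \<times> pverts G \<longrightarrow> finite (parcs G)"
    by (meson finite_SigmaI finite_subset)
  moreover have "(\<forall>e. e \<in> parcs G \<longrightarrow> fst e \<in> pverts G) \<and> (\<forall>e. e \<in> parcs G \<longrightarrow> snd e \<in> pverts G) \<longleftrightarrow>
      parcs G \<subseteq> pverts G \<times> pverts G"
    by fastforce
  moreover have "(\<forall>e. e \<in> parcs G \<longrightarrow> fst e \<noteq> snd e) \<longleftrightarrow> (\<forall>x. (x, x) \<notin> parcs G)"
    by fastforce
  ultimately show ?thesis
    unfolding pair_graph_def pair_digraph_def pair_pseudo_graph_def pair_fin_digraph_def
      pair_fin_digraph_axioms_def pair_wf_digraph_def pair_loopfree_digraph_def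
      pair_loopfree_digraph_axioms_def pair_sym_digraph_def pair_sym_digraph_axioms_def
      symmetric_def with_proj_simps
    by argo
qed

text \<open>
  An injective labelling is a ranking, so the minimum that defines the tree-depth is
  attained.
\<close>

lemma tree_depth_le_iff:
  assumes "pair_graph G"
  shows "tree_depth G \<le> k \<longleftrightarrow> (\<exists>f. ranks k (pverts G) (parcs G) {} f)"
proof -
  let ?R = "\<lambda>k. \<exists>f. ranks k (pverts G) (parcs G) {} f"
  have td: "tree_depth G = (LEAST k. ?R k)"
    unfolding tree_depth_def is_ranking_iff_ranks[OF pair_graph_wf[OF assms]] ..
  have "finite (pverts G)" using assms by (simp add: pair_graph_iff)
  from finite_imp_inj_to_nat_seg[OF this]
  obtain f n where f: "f ` pverts G = {i::nat. i < n}" "inj_on f (pverts G)"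
    by (elim exE conjE)
  have "f x < n" if "x \<in> pverts G" for x using imageI[OF that, of f] unfolding f(1) by simp
  then have n: "ranks n (pverts G) (parcs G) {} (\<lambda>x. Suc (f x))"
    by (intro ranksI) (simp_all add: Suc_le_eq inj_on_eq_iff[OF f(2)])
  have "?R n" by (rule exI, rule n)
  then have "?R (tree_depth G)" unfolding td by (rule LeastI)
  then show ?thesis
    unfolding td by (auto intro: ranks_le Least_le)
qed

section \<open>Tree-depth and minor steps\<close>

abbreviation delete_vertex :: "'a \<Rightarrow> 'a pair_pre_digraph \<Rightarrow> 'a pair_pre_digraph" where
  "delete_vertex v G \<equiv>
     \<lparr> pverts = pverts G - {v}, parcs = {(x, y) \<in> parcs G. x \<noteq> v \<and> y \<noteq> v} \<rparr>"

abbreviation delete_edge :: "'a \<Rightarrow> 'a \<Rightarrow> 'a pair_pre_digraph \<Rightarrow> 'a pair_pre_digraph" where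
  "delete_edge u v G \<equiv> \<lparr> pverts = pverts G, parcs = parcs G - edge u v \<rparr>"

abbreviation contract :: "'a \<Rightarrow> 'a \<Rightarrow> 'a pair_pre_digraph \<Rightarrow> 'a pair_pre_digraph" where
  "contract u v G \<equiv> identify_verts (\<lambda>x. if x = v then u else x) G"

lemma sym_map_prod: "sym E \<Longrightarrow> sym (map_prod c c ` E - Id)"
  by (force simp: sym_def)

lemma pair_graph_identify_verts: "pair_graph G \<Longrightarrow> pair_graph (identify_verts c G)"
  unfolding pair_graph_iff identify_verts_def by (auto intro!: sym_map_prod)

lemma pair_graph_minor_step: "minor_step G M \<Longrightarrow> pair_graph G \<Longrightarrow> pair_graph M"
proof (induction rule: minor_step.induct)
  case (contract_edge u v G)
  then show ?case by (simp add: pair_graph_identify_verts)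
qed (auto simp: pair_graph_iff sym_def)

text \<open>
  The tree-depth of a contraction is read off from labellings of the original graph: a ranking of
  the contraction is composed with the contraction map, and conversely a labelling that agrees on
  \<open>u\<close> and \<open>v\<close> is restricted to the remaining vertices. In the second direction each arc of the
  contraction is lifted to an arc of \<open>G\<close>, with detours along \<open>uv\<close> at its ends, and these detours
  do not exceed the label bound because \<open>u\<close> and \<open>v\<close> carry the same label.
\<close>

lemma tree_depth_contract_le_iff:
  assumes G: "pair_graph G" and uv: "(u, v) \<in> parcs G"
  shows "tree_depth (contract u v G) \<le> k \<longleftrightarrow> (\<exists>g. ranks k (pverts G) (parcs G) (edge u v) g)"
proof -
  define c where "c = (\<lambda>x. if x = v then u else x)"
  let ?M = "identify_verts c G"
  have V: "pverts ?M = c ` pverts G" and E: "parcs ?M = map_prod c c ` parcs G - Id"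
    by (simp_all add: identify_verts_def)
  have wf: "u \<in> pverts G" "v \<in> pverts G" "u \<noteq> v" "(v, u) \<in> parcs G"
    using G uv by (auto simp: pair_graph_iff dest: symD)
  have c_eq: "x = y \<or> (x, y) \<in> edge u v" if "c x = c y" for x y
    using that by (auto simp: c_def split: if_splits)
  have "(\<exists>f. ranks k (pverts ?M) (parcs ?M) {} f) \<longleftrightarrow>
        (\<exists>g. ranks k (pverts G) (parcs G) (edge u v) g)"
  proof safe
    fix f assume f: "ranks k (pverts ?M) (parcs ?M) {} f"
    have "ranks k (pverts G) (parcs G) (edge u v) (\<lambda>x. f (c x))"
    proof (rule ranksI)
      fix x y
      assume xy: "x \<in> pverts G" "y \<in> pverts G" "f (c x) = f (c y)"
        and reach: "(x, y) \<in> (below (parcs G) (\<lambda>x. f (c x)) (f (c x)))\<^sup>*"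
      have "(c x, c y) \<in> (below (parcs ?M) f (f (c x)))\<^sup>*"
      proof (rule rtrancl_transfer[OF reach])
        fix a b assume ab: "(a, b) \<in> below (parcs G) (\<lambda>x. f (c x)) (f (c x))"
        show "(c a, c b) \<in> (below (parcs ?M) f (f (c x)))\<^sup>*"
        proof (cases "c a = c b")
          case False
          then have "(c a, c b) \<in> below (parcs ?M) f (f (c x))"
            using ab unfolding below_iff E by (auto intro: map_prod_imageI)
          then show ?thesis by blast
        qed simp
      qed
      then have "c x = c y" using ranksD(4)[OF f, of "c x" "c y"] xy V by auto
      then show "x = y \<or> (x, y) \<in> edge u v" by (rule c_eq)
    next
      fix x assume "x \<in> pverts G"
      then show "1 \<le> f (c x) \<and> f (c x) \<le> k" using ranksD(1,2)[OF f] V by blast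
    qed (auto simp: c_def)
    then show "\<exists>g. ranks k (pverts G) (parcs G) (edge u v) g" by blast
  next
    fix g assume g: "ranks k (pverts G) (parcs G) (edge u v) g"
    have guv: "g u = g v" using ranksD(3)[OF g] by auto
    then have gc: "g (c x) = g x" for x by (auto simp: c_def)
    have "ranks k (pverts ?M) (parcs ?M) {} g"
    proof (rule ranksI)
      fix x y
      assume xy: "x \<in> pverts ?M" "y \<in> pverts ?M" "g x = g y"
        and reach: "(x, y) \<in> (below (parcs ?M) g (g x))\<^sup>*"
      have to: "(a, c a) \<in> (below (parcs G) g m)\<^sup>*" "(c a, a) \<in> (below (parcs G) g m)\<^sup>*"
        if "g a \<le> m" for a m
        using that uv wf guv by (auto simp: c_def below_iff)
      have "(x, y) \<in> (below (parcs G) g (g x))\<^sup>*"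
      proof (rule rtrancl_transfer[OF reach, where f = "\<lambda>x. x"])
        fix a' b' assume ab': "(a', b') \<in> below (parcs ?M) g (g x)"
        then obtain a b where ab: "(a, b) \<in> parcs G" "a' = c a" "b' = c b"
          by (auto simp: below_iff E)
        with ab' have "g a \<le> g x" "g b \<le> g x" by (auto simp: below_iff gc)
        with ab have "(a, b) \<in> (below (parcs G) g (g x))\<^sup>*" by (auto simp: below_iff)
        with to \<open>g a \<le> g x\<close> \<open>g b \<le> g x\<close> show "(a', b') \<in> (below (parcs G) g (g x))\<^sup>*"
          unfolding ab by (meson rtrancl_trans)
      qed
      moreover have "x \<in> pverts G - {v}" "y \<in> pverts G - {v}"
        using xy wf unfolding V by (auto simp: c_def)
      ultimately show "x = y \<or> (x, y) \<in> {}" using ranksD(4)[OF g, of x y] xy by auto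
    next
      fix x assume "x \<in> pverts ?M"
      then have "x \<in> pverts G" using wf unfolding V by (auto simp: c_def)
      then show "1 \<le> g x \<and> g x \<le> k" using ranksD[OF g] by auto
    qed auto
    then show "\<exists>f. ranks k (pverts ?M) (parcs ?M) {} f" by blast
  qed
  then show ?thesis
    using tree_depth_le_iff[OF pair_graph_identify_verts[OF G], of c k]
    unfolding c_def[symmetric] by simp
qed

text \<open>
  Giving the merged vertex the larger of the two old labels shows that contraction does not
  increase the tree-depth. Raising labels only shrinks the components of low label, and a vertex
  whose label was raised is represented by its partner, which had that label before.
\<close>

lemma ranks_contract_max:
  assumes f: "ranks k V E {} f" and uv: "u \<in> V" "v \<in> V" "(u, v) \<in> E" "(v, u) \<in> E"
  shows "ranks k V E (edge u v) (f(u := max (f u) (f v), v := max (f u) (f v)))"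
    (is "ranks k V E _ ?g")
proof (rule ranksI)
  fix x y
  assume xy: "x \<in> V" "y \<in> V" "?g x = ?g y" and reach: "(x, y) \<in> (below E ?g (?g x))\<^sup>*"
  define m where "m = ?g x"
  have sub: "below E ?g m \<subseteq> below E f m" by (auto simp: below_iff split: if_splits)
  \<comment> \<open>The end of \<open>uv\<close> with the larger old label represents both ends.\<close>
  have rep: "\<exists>a'. a' \<in> V \<and> f a' = m \<and> (a = a' \<or> (a, a') \<in> edge u v) \<and>
      (a, a') \<in> (below E f m)\<^sup>* \<and> (a', a) \<in> (below E f m)\<^sup>*" if a: "a \<in> V" "?g a = m" for a
  proof (cases "f a = m")
    case True
    then show ?thesis using a by blast
  next
    case False
    then have "\<exists>a'. f a' = m \<and> f a \<le> m \<and> (a, a') \<in> edge u v"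
      using a by (auto simp: max_def split: if_splits)
    then show ?thesis using uv by (fastforce simp: below_iff)
  qed
  obtain x' where x': "x' \<in> V" "f x' = m" "x = x' \<or> (x, x') \<in> edge u v" "(x', x) \<in> (below E f m)\<^sup>*"
    using rep[of x] xy by (auto simp: m_def)
  obtain y' where y': "y' \<in> V" "f y' = m" "y = y' \<or> (y, y') \<in> edge u v" "(y, y') \<in> (below E f m)\<^sup>*"
    using rep[of y] xy m_def by metis
  have "(x, y) \<in> (below E f m)\<^sup>*" using reach sub unfolding m_def[symmetric] by (meson rtrancl_mono subsetD)
  then have "(x', y') \<in> (below E f m)\<^sup>*" using x' y' by (meson rtrancl_trans)
  then have "x' = y'" using ranksD(4)[OF f, of x' y'] x' y' by auto
  then show "x = y \<or> (x, y) \<in> edge u v" using x'(3) y'(3) by auto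
qed (use ranksD[OF f] uv in \<open>auto simp: max_def\<close>)

lemma tree_depth_minor_step_le:
  assumes "minor_step G M" "pair_graph G"
  shows "tree_depth M \<le> tree_depth G"
proof -
  obtain f where f: "ranks (tree_depth G) (pverts G) (parcs G) {} f"
    using tree_depth_le_iff[OF assms(2)] by blast
  note M = pair_graph_minor_step[OF assms]
  from assms(1) show ?thesis
  proof cases
    case (del_vertex v)
    then have "pverts M \<subseteq> pverts G" "parcs M \<subseteq> parcs G" by auto
    then show ?thesis using ranks_subgraph[OF f] tree_depth_le_iff[OF M] by blast
  next
    case (del_edge u v)
    then have "pverts M \<subseteq> pverts G" "parcs M \<subseteq> parcs G" by auto
    then show ?thesis using ranks_subgraph[OF f] tree_depth_le_iff[OF M] by blast
  next
    case (contract_edge u v)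
    then have "u \<in> pverts G" "v \<in> pverts G" "(v, u) \<in> parcs G"
      using assms(2) by (auto simp: pair_graph_iff dest: symD)
    then show ?thesis
      using ranks_contract_max[OF f] contract_edge tree_depth_contract_le_iff[OF assms(2)] by blast
  qed
qed

lemma tree_depth_proper_minor_less:
  assumes G: "pair_graph G" and step: "\<And>M. minor_step G M \<Longrightarrow> tree_depth M < k"
    and "proper_minor M G"
  shows "tree_depth M < k"
proof -
  have "minor_step\<^sup>+\<^sup>+ G M" using assms(3) by (simp add: proper_minor_def)
  then have "pair_graph M \<and> tree_depth M < k"
    by (induction rule: tranclp_induct)
      (auto simp: G step pair_graph_minor_step intro: le_less_trans[OF tree_depth_minor_step_le])
  then show ?thesis ..
qed

text \<open>
  Since minor steps never increase the tree-depth, criticality only has to be tested on the minors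
  obtained by a single step.
\<close>

lemma critical_Suc_iff:
  assumes G: "pair_graph G"
  shows "critical (Suc k) G \<longleftrightarrow> tree_depth G = Suc k \<and>
    (\<forall>v \<in> pverts G. \<exists>f. ranks k (pverts G - {v}) (Restr (parcs G) (- {v})) {} f) \<and>
    (\<forall>u v. (u, v) \<in> parcs G \<longrightarrow>
       (\<exists>f. ranks k (pverts G) (parcs G - edge u v) {} f) \<and>
       (\<exists>f. ranks k (pverts G) (parcs G) (edge u v) f))"
    (is "_ \<longleftrightarrow> _ \<and> ?V \<and> ?E")
proof -
  have Restr: "{(x, y) \<in> E. x \<noteq> v \<and> y \<noteq> v} = Restr E (- {v})" for E :: "'a rel" and v by auto
  have dv: "tree_depth (delete_vertex v G) \<le> k \<longleftrightarrow>
      (\<exists>f. ranks k (pverts G - {v}) (Restr (parcs G) (- {v})) {} f)" if "v \<in> pverts G" for v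
    using tree_depth_le_iff[OF pair_graph_minor_step[OF minor_step.del_vertex[OF that] G]]
    by (simp add: Restr)
  have de: "tree_depth (delete_edge u v G) \<le> k \<longleftrightarrow>
      (\<exists>f. ranks k (pverts G) (parcs G - edge u v) {} f)" if "(u, v) \<in> parcs G" for u v
    using tree_depth_le_iff[OF pair_graph_minor_step[OF minor_step.del_edge[OF that] G]] by simp
  have "(\<forall>M. minor_step G M \<longrightarrow> tree_depth M \<le> k) \<longleftrightarrow> ?V \<and> ?E"
  proof (intro iffI conjI ballI allI impI)
    fix M assume "?V \<and> ?E" and "minor_step G M"
    from this(2) this(1) show "tree_depth M \<le> k"
      by cases (simp_all add: dv de tree_depth_contract_le_iff[OF G])
  next
    fix u v assume "\<forall>M. minor_step G M \<longrightarrow> tree_depth M \<le> k" and uv: "(u, v) \<in> parcs G"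
    then show "\<exists>f. ranks k (pverts G) (parcs G - edge u v) {} f"
      and "\<exists>f. ranks k (pverts G) (parcs G) (edge u v) f"
      using de[OF uv] tree_depth_contract_le_iff[OF G uv]
        minor_step.del_edge[OF uv] minor_step.contract_edge[OF uv] by blast+
  next
    fix v assume "\<forall>M. minor_step G M \<longrightarrow> tree_depth M \<le> k" and v: "v \<in> pverts G"
    then show "\<exists>f. ranks k (pverts G - {v}) (Restr (parcs G) (- {v})) {} f"
      using dv[OF v] minor_step.del_vertex[OF v] by blast
  qed
  moreover have "(\<forall>M. proper_minor M G \<longrightarrow> tree_depth M < Suc k) \<longleftrightarrow>
      (\<forall>M. minor_step G M \<longrightarrow> tree_depth M \<le> k)"
    using tree_depth_proper_minor_less[OF G, of "Suc k"]
    by (auto simp: proper_minor_def less_Suc_eq_le)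
  ultimately show ?thesis unfolding critical_def by simp
qed

text \<open>
  If \<open>y\<close> were outside the component \<open>C\<close> of \<open>x\<close>, a ranking of \<open>G - y\<close> with \<open>k\<close> labels would cover
  \<open>C\<close>, one of \<open>G - x\<close> would cover the rest, and together they would rank \<open>G\<close> with \<open>k\<close> labels.
\<close>

lemma critical_connected:
  assumes G: "pair_graph G" and crit: "critical (Suc k) G"
    and x: "x \<in> pverts G" and y: "y \<in> pverts G"
  shows "(x, y) \<in> (parcs G)\<^sup>*"
proof (rule ccontr)
  assume not_xy: "(x, y) \<notin> (parcs G)\<^sup>*"
  define C where "C = {z. (x, z) \<in> (parcs G)\<^sup>*}"
  have C: "x \<in> C" "y \<notin> C" using not_xy by (auto simp: C_def)
  have closed: "a \<in> C \<longleftrightarrow> b \<in> C" if "(a, b) \<in> parcs G" for a b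
    using that G by (auto simp: C_def pair_graph_iff dest: symD intro: rtrancl_into_rtrancl)
  obtain f where f: "ranks k (pverts G - {y}) (Restr (parcs G) (- {y})) {} f"
    using crit y by (auto simp: critical_Suc_iff[OF G])
  obtain g where g: "ranks k (pverts G - {x}) (Restr (parcs G) (- {x})) {} g"
    using crit x by (auto simp: critical_Suc_iff[OF G])
  define h where "h = (\<lambda>z. if z \<in> C then f z else g z)"
  have "ranks k (pverts G) (parcs G) {} h"
  proof (rule ranksI)
    fix a b
    assume ab: "a \<in> pverts G" "b \<in> pverts G" "h a = h b"
      and reach: "(a, b) \<in> (below (parcs G) h (h a))\<^sup>*"
    define m where "m = h a"
    have reach: "(a, b) \<in> (below (parcs G) h m)\<^sup>*" using reach by (simp add: m_def)
    then have same: "(b \<in> C \<longleftrightarrow> a \<in> C) \<and> (a, b) \<in>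
        (if a \<in> C then below (Restr (parcs G) (- {y})) f m else below (Restr (parcs G) (- {x})) g m)\<^sup>*"
    proof induction
      case (step b c)
      then have "(b, c) \<in> (if a \<in> C then below (Restr (parcs G) (- {y})) f m
          else below (Restr (parcs G) (- {x})) g m)"
        using closed C by (auto simp: below_iff h_def)
      then show ?case using step closed by (auto simp: below_iff intro: rtrancl_into_rtrancl)
    qed auto
    show "a = b \<or> (a, b) \<in> {}"
    proof (cases "a \<in> C")
      case True
      with same ab C show ?thesis
        using ranksD(4)[OF f, of a b] by (auto simp: h_def m_def)
    next
      case False
      with same ab C show ?thesis
        using ranksD(4)[OF g, of a b] by (auto simp: h_def m_def)
    qed
  next
    fix z assume z: "z \<in> pverts G"
    show "1 \<le> h z \<and> h z \<le> k"
      using ranksD(1,2)[OF f, of z] ranksD(1,2)[OF g, of z] z C by (auto simp: h_def)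
  qed auto
  then have "tree_depth G \<le> k" using tree_depth_le_iff[OF G] by blast
  with crit show False by (simp add: critical_def)
qed

section \<open>Rankings of rooted products\<close>

text \<open>
  The rooted product: a copy of \<open>F a\<close>, called the bag of \<open>a\<close>, is attached at its root \<open>w a\<close> to each
  vertex \<open>a\<close> of the core \<open>(V, E)\<close>. The root \<open>(a, w a)\<close> is the vertex \<open>a\<close> of the core, so no
  identification is needed. Sets of contracted edges are assembled in the same way.
\<close>

definition rooted_arcs :: "'a set \<Rightarrow> 'a rel \<Rightarrow> ('a \<Rightarrow> 'b rel) \<Rightarrow> ('a \<Rightarrow> 'b) \<Rightarrow> ('a \<times> 'b) rel" where
  "rooted_arcs V E F w =
     {((a, w a), (b, w b)) | a b. (a, b) \<in> E} \<union>
     {((a, x), (a, y)) | a x y. a \<in> V \<and> (x, y) \<in> F a}"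

text \<open>
  Labels up to \<open>t\<close> are used inside the bags and labels above \<open>t\<close> only at roots, where they come from
  the labelling \<open>h\<close> of the core, raised by \<open>c\<close>. If the raised core label of \<open>a\<close> is at most \<open>t\<close>, the
  bag of \<open>a\<close> is labelled as a whole by \<open>b a\<close>, root included.
\<close>

definition rooted_label ::
    "nat \<Rightarrow> nat \<Rightarrow> ('a \<Rightarrow> 'b) \<Rightarrow> ('a \<Rightarrow> nat) \<Rightarrow> ('a \<Rightarrow> 'b \<Rightarrow> nat) \<Rightarrow> 'a \<times> 'b \<Rightarrow> nat" where
  "rooted_label t c w h b = (\<lambda>(a, x). if x = w a \<and> t < h a + c then h a + c else b a x)"

text \<open>
  A component of low label that uses only labels up to \<open>t\<close> cannot leave its bag: an arc between two
  bags has roots as ends, both with raised core label at most \<open>t\<close>, and since \<open>t \<le> c + 1\<close> these core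
  labels are both 1, which a ranking of the core forbids for adjacent vertices unless their edge is contracted; the
  ends of contracted edges of the core are assumed to lie above \<open>t\<close>. Hence small
  labels are controlled by the rankings of the bags. Labels above \<open>t\<close> occur only at roots, and
  a walk between two roots projects to a walk of the core with the same bound on the core labels,
  because a walk can change the bag only at roots; so large labels are controlled by \<open>h\<close>. The two
  useful choices are \<open>c = t\<close>, with every root above \<open>t\<close>, and \<open>c = t - 1\<close>, which leaves the roots of
  core label 1 to their bags.
\<close>

lemma ranks_rooted:
  assumes h: "ranks s V E D h"
    and E: "E \<subseteq> V \<times> V" "\<And>a. (a, a) \<notin> E"
    and D: "\<And>a b. (a, b) \<in> D \<Longrightarrow> t < h a + c"
    and low: "\<And>a. \<lbrakk>a \<in> V; h a + c \<le> t\<rbrakk> \<Longrightarrow> ranks t (W a) (F a) (C a) (b a)"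
    and high: "\<And>a. \<lbrakk>a \<in> V; t < h a + c\<rbrakk> \<Longrightarrow>
      ranks t (W a - {w a}) (Restr (F a) (- {w a})) {} (b a) \<and> C a = {}"
    and t: "t \<le> Suc c" "t \<le> k" and k: "s + c \<le> k"
  shows "ranks k (Sigma V W) (rooted_arcs V E F w) (rooted_arcs V D C w) (rooted_label t c w h b)"
    (is "ranks k _ ?E ?D ?L")
proof (rule ranksI)
  fix z assume "z \<in> Sigma V W"
  then obtain a x where z: "z = (a, x)" "a \<in> V" "x \<in> W a" by auto
  show "1 \<le> ?L z \<and> ?L z \<le> k"
  proof (cases "t < h a + c")
    case True
    then show ?thesis
      using ranksD(1,2)[OF high[OF z(2), THEN conjunct1], of x] ranksD(1,2)[OF h z(2)] t k z
      by (auto simp: rooted_label_def)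
  next
    case False
    then show ?thesis
      using ranksD(1,2)[OF low[OF z(2)] z(3)] t z by (auto simp: rooted_label_def)
  qed
next
  fix z z' assume "(z, z') \<in> ?D"
  then consider a b where "(a, b) \<in> D" "z = (a, w a)" "z' = (b, w b)"
    | a x y where "a \<in> V" "(x, y) \<in> C a" "z = (a, x)" "z' = (a, y)"
    by (auto simp: rooted_arcs_def)
  then show "?L z = ?L z'"
  proof cases
    case (1 a b)
    then show ?thesis using D[OF 1(1)] ranksD(3)[OF h 1(1)] by (simp add: rooted_label_def)
  next
    case (2 a x y)
    then have "h a + c \<le> t" using high[of a] by fastforce
    then show ?thesis using ranksD(3)[OF low[OF 2(1)] 2(2)] 2 by (simp add: rooted_label_def)
  qed
next
  fix z z'
  assume zz: "z \<in> Sigma V W" "z' \<in> Sigma V W" "?L z = ?L z'"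
    and reach: "(z, z') \<in> (below ?E ?L (?L z))\<^sup>*"
  obtain a x where z: "z = (a, x)" "a \<in> V" "x \<in> W a" using zz(1) by auto
  obtain a' x' where z': "z' = (a', x')" "a' \<in> V" "x' \<in> W a'" using zz(2) by auto
  define m where "m = ?L z"
  have reach: "(z, z') \<in> (below ?E ?L m)\<^sup>*" using reach by (simp add: m_def)
  have small: "b a x \<le> t" if "a \<in> V" "x \<in> W a" "\<not> (x = w a \<and> t < h a + c)" for a x
  proof (cases "t < h a + c")
    case True
    then show ?thesis using ranksD(2)[OF high[OF that(1), THEN conjunct1], of x] that by auto
  next
    case False
    then show ?thesis using ranksD(2)[OF low[OF that(1)] that(2)] by auto
  qed
  show "z = z' \<or> (z, z') \<in> ?D"
  proof (cases "t < m")
    case True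
    then have x: "x = w a" "m = h a + c" and hx: "t < h a + c"
      using small[OF z(2,3)] z(1) by (auto simp: m_def rooted_label_def split: if_splits)
    have x': "x' = w a'" "m = h a' + c"
      using True small[OF z'(2,3)] z'(1) zz(3) by (auto simp: m_def rooted_label_def split: if_splits)
    have "(fst z, fst z') \<in> (below E h (h a))\<^sup>*"
    proof (rule rtrancl_transfer[OF reach])
      fix p q assume "(p, q) \<in> below ?E ?L m"
      then have pq: "(p, q) \<in> ?E" "?L p \<le> m" "?L q \<le> m" by (auto simp: below_iff)
      show "(fst p, fst q) \<in> (below E h (h a))\<^sup>*"
      proof (cases "fst p = fst q")
        case False
        with pq(1) have p: "p = (fst p, w (fst p))" "q = (fst q, w (fst q))" "(fst p, fst q) \<in> E"
          by (auto simp: rooted_arcs_def)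
        have "h d \<le> h a" if "?L (d, w d) \<le> m" for d
          using that x hx by (auto simp: rooted_label_def split: if_splits)
        then have "h (fst p) \<le> h a" "h (fst q) \<le> h a" using pq p by metis+
        then show ?thesis using p by (auto simp: below_iff)
      qed simp
    qed
    then have "a = a' \<or> (a, a') \<in> D" using ranksD(4)[OF h z(2) z'(2)] x x' z z' by simp
    then show ?thesis using x x' z z' by (auto simp: rooted_arcs_def)
  next
    case False
    \<comment> \<open>Labels up to \<open>t\<close> never cross between bags.\<close>
    have no_cross: "\<not> ((p, q) \<in> E \<and> h p + c \<le> t \<and> h q + c \<le> t)" for p q
    proof
      assume pq: "(p, q) \<in> E \<and> h p + c \<le> t \<and> h q + c \<le> t"
      then have V: "p \<in> V" "q \<in> V" using E by auto
      then have "h p = 1" "h q = 1" using ranksD(1)[OF h, of p] ranksD(1)[OF h, of q] t pq by auto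
      moreover from this pq have "(p, q) \<in> (below E h (h p))\<^sup>*"
        by (intro r_into_rtrancl) (simp add: below_iff)
      ultimately have "p = q \<or> (p, q) \<in> D" using ranksD(4)[OF h V] by simp
      then show False using pq E(2) D[of p q] by auto
    qed
    define A where "A = (if t < h a + c then Restr (F a) (- {w a}) else F a)"
    have bag: "fst z' = a \<and> (x, snd z') \<in> (below A (b a) m)\<^sup>*"
      using reach
    proof induction
      case (step p q)
      then have pq: "(p, q) \<in> ?E" "?L p \<le> m" "?L q \<le> m" and p: "fst p = a" by (auto simp: below_iff)
      have root: "h d + c \<le> t" if "?L (d, w d) \<le> m" for d
        using that False by (auto simp: rooted_label_def split: if_splits)
      from pq(1) consider d e where "(d, e) \<in> E" "p = (d, w d)" "q = (e, w e)"
        | y y' where "(y, y') \<in> F a" "p = (a, y)" "q = (a, y')"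
        using p by (auto simp: rooted_arcs_def)
      then show ?case
      proof cases
        case 1
        then show ?thesis using no_cross root pq by blast
      next
        case (2 y y')
        then have "(y, y') \<in> below A (b a) m"
          using pq root False by (auto simp: A_def below_iff rooted_label_def split: if_splits)
        then show ?thesis using 2 step by (auto intro: rtrancl_into_rtrancl)
      qed
    qed (simp add: z)
    then have a': "a' = a" and xx': "(x, x') \<in> (below A (b a) m)\<^sup>*" using z' by auto
    have m: "m = b a x" "m = b a x'" and nw: "t < h a + c \<Longrightarrow> x \<noteq> w a \<and> x' \<noteq> w a"
      using False zz(3) z z' a' by (auto simp: m_def rooted_label_def split: if_splits)
    show ?thesis
    proof (cases "t < h a + c")
      case True
      then have "x = x'"
        using ranksD(4)[OF high[OF z(2), THEN conjunct1], of x x'] m nw xx' z z' a'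
        by (auto simp: A_def)
      then show ?thesis using z z' a' by simp
    next
      case False
      then have "x = x' \<or> (x, x') \<in> C a"
        using ranksD(4)[OF low[OF z(2)], of x x'] m xx' z z' a' by (auto simp: A_def)
      then show ?thesis using z z' a' by (auto simp: rooted_arcs_def)
    qed
  qed
qed

text \<open>
  The lower bound. Each bag needs more than \<open>r\<close> labels, so its largest label exceeds \<open>r\<close>. The
  largest labels of the bags, lowered by \<open>r\<close>, rank the core: since the bags are connected, a walk of
  the core joining two vertices extends to a walk joining vertices of largest label in the two
  bags, and it meets labels no larger than the maxima of the bags it visits.
\<close>

lemma ranks_rooted_bound:
  assumes L: "ranks k (Sigma V W) (rooted_arcs V E F w) {} L"
    and fin: "\<And>a. a \<in> V \<Longrightarrow> finite (W a)"
    and root: "\<And>a. a \<in> V \<Longrightarrow> w a \<in> W a"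
    and F: "\<And>a. a \<in> V \<Longrightarrow> F a \<subseteq> W a \<times> W a"
    and conn: "\<And>a x y. \<lbrakk>a \<in> V; x \<in> W a; y \<in> W a\<rbrakk> \<Longrightarrow> (x, y) \<in> (F a)\<^sup>*"
    and deep: "\<And>a f. a \<in> V \<Longrightarrow> \<not> ranks r (W a) (F a) {} f"
    and E: "E \<subseteq> V \<times> V"
  shows "\<exists>h. ranks (k - r) V E {} h"
proof -
  let ?E = "rooted_arcs V E F w"
  define M where "M a = Max ((\<lambda>x. L (a, x)) ` W a)" for a
  have M_ge: "L (a, x) \<le> M a" if "a \<in> V" "x \<in> W a" for a x
    using that fin by (auto simp: M_def)
  have M_ex: "\<exists>x \<in> W a. L (a, x) = M a" if "a \<in> V" for a
  proof -
    have "M a \<in> (\<lambda>x. L (a, x)) ` W a"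
      unfolding M_def using fin[OF that] root[OF that] by (intro Max_in) auto
    then show ?thesis by auto
  qed
  have M_gt: "r < M a" if a: "a \<in> V" for a
  proof (rule ccontr)
    assume "\<not> r < M a"
    have "ranks k (W a) (F a) {} (\<lambda>x. L (a, x))"
      by (rule ranks_pullback[OF L]) (use a in \<open>auto simp: rooted_arcs_def inj_on_def\<close>)
    then have "ranks r (W a) (F a) {} (\<lambda>x. L (a, x))"
      using M_ge[OF a] \<open>\<not> r < M a\<close> unfolding ranks_def by fastforce
    with deep[OF a] show False by blast
  qed
  have bag_conn: "((a, x), (a, y)) \<in> (below ?E L m)\<^sup>*"
    if a: "a \<in> V" "M a \<le> m" and xy: "x \<in> W a" "y \<in> W a" for a x y m
  proof (rule rtrancl_transfer[OF conn[OF a(1) xy], where f = "Pair a"])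
    fix p q assume "(p, q) \<in> F a"
    then show "((a, p), (a, q)) \<in> (below ?E L m)\<^sup>*"
      using F[OF a(1)] M_ge[OF a(1), of p] M_ge[OF a(1), of q] a
      by (intro r_into_rtrancl) (auto simp: below_iff rooted_arcs_def)
  qed
  have "ranks (k - r) V E {} (\<lambda>a. M a - r)"
  proof (rule ranksI)
    fix a assume a: "a \<in> V"
    then obtain x where "x \<in> W a" "L (a, x) = M a" using M_ex by blast
    then have "M a \<le> k" using ranksD(2)[OF L, of "(a, x)"] a by simp
    then show "1 \<le> M a - r \<and> M a - r \<le> k - r"
      using M_gt[OF a] by (simp add: diff_le_mono)
  next
    fix a b
    assume ab: "a \<in> V" "b \<in> V" "M a - r = M b - r"
      and reach: "(a, b) \<in> (below E (\<lambda>a. M a - r) (M a - r))\<^sup>*"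
    have Mab: "M a = M b" using ab M_gt[of a] M_gt[of b] by simp
    obtain x where x: "x \<in> W a" "L (a, x) = M a" using M_ex ab by blast
    obtain y where y: "y \<in> W b" "L (b, y) = M b" using M_ex ab by blast
    have "((a, w a), (b, w b)) \<in> (below ?E L (M a))\<^sup>*"
    proof (rule rtrancl_transfer[OF reach, where f = "\<lambda>a. (a, w a)"])
      fix p q assume pq: "(p, q) \<in> below E (\<lambda>a. M a - r) (M a - r)"
      then have V: "p \<in> V" "q \<in> V" using E by (auto simp: below_iff)
      then have "M p \<le> M a" "M q \<le> M a"
        using pq M_gt[OF ab(1)] by (auto simp: below_iff)
      then have "L (p, w p) \<le> M a" "L (q, w q) \<le> M a"
        using M_ge[of p "w p"] M_ge[of q "w q"] V root by fastforce+
      then show "((p, w p), (q, w q)) \<in> (below ?E L (M a))\<^sup>*"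
        using pq by (intro r_into_rtrancl) (auto simp: below_iff rooted_arcs_def)
    qed
    moreover have "((a, x), (a, w a)) \<in> (below ?E L (M a))\<^sup>*"
      using bag_conn ab x root by auto
    moreover have "((b, w b), (b, y)) \<in> (below ?E L (M a))\<^sup>*"
      using bag_conn ab y root Mab by auto
    ultimately have "((a, x), (b, y)) \<in> (below ?E L (M a))\<^sup>*" by (meson rtrancl_trans)
    then have "(a, x) = (b, y)"
      using ranksD(4)[OF L, of "(a, x)" "(b, y)"] ab x y Mab by auto
    then show "a = b \<or> (a, b) \<in> {}" by simp
  qed auto
  then show ?thesis by blast
qed

section \<open>1-uniqueness\<close>

text \<open>
  This is where 1-uniqueness enters: a vertex that alone carries the label 1 can be removed together
  with its label, so its deletion lowers the tree-depth.
\<close>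

lemma ranks_remove_lowest:
  assumes f: "ranks (Suc k) V E {} f" and z: "\<And>x. \<lbrakk>x \<in> V; f x = 1\<rbrakk> \<Longrightarrow> x = z"
  shows "ranks k (V - {z}) (Restr E (- {z})) {} (\<lambda>x. f x - 1)"
proof (rule ranksI)
  have pos: "2 \<le> f x" if "x \<in> V - {z}" for x
    using ranksD(1)[OF f, of x] z[of x] that by (cases "f x = 1") auto
  show "1 \<le> f x - 1 \<and> f x - 1 \<le> k" if "x \<in> V - {z}" for x
    using pos[OF that] ranksD(2)[OF f, of x] that by auto
  fix x y
  assume xy: "x \<in> V - {z}" "y \<in> V - {z}" "f x - 1 = f y - 1"
    and reach: "(x, y) \<in> (below (Restr E (- {z})) (\<lambda>x. f x - 1) (f x - 1))\<^sup>*"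
  have "f x = f y" using xy pos[of x] pos[of y] by auto
  moreover have "below (Restr E (- {z})) (\<lambda>x. f x - 1) (f x - 1) \<subseteq> below E f (f x)"
    using pos[OF xy(1)] by (auto simp: below_iff)
  then have "(x, y) \<in> (below E f (f x))\<^sup>*" using reach by (meson rtrancl_mono subsetD)
  ultimately show "x = y \<or> (x, y) \<in> {}" using ranksD(4)[OF f] xy by auto
qed auto

lemma one_unique_iff:
  assumes "pair_graph G"
  shows "one_unique G \<longleftrightarrow> (\<forall>z \<in> pverts G. \<exists>f. ranks (tree_depth G) (pverts G) (parcs G) {} f \<and>
           (\<forall>x \<in> pverts G. f x = 1 \<longleftrightarrow> x = z))"
  unfolding one_unique_def optimal_ranking_def is_ranking_iff_ranks[OF pair_graph_wf[OF assms]]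
  by (intro ball_cong refl ex_cong1 conj_cong) auto

section \<open>Critical rooted products\<close>

text \<open>
  A graph \<open>G\<close> on any vertex type that is identified with a rooted product by the isomorphism \<open>\<kappa>\<close>; the
  bag of \<open>a\<close> is the graph \<open>M a\<close>. Working up to \<open>\<kappa>\<close> separates the combinatorics of the
  product from the encoding of glued vertices.
\<close>

locale rooted_product =
  fixes H :: "'a pair_pre_digraph" and M :: "'a \<Rightarrow> 'b pair_pre_digraph" and w :: "'a \<Rightarrow> 'b"
    and G :: "'c pair_pre_digraph" and \<kappa> :: "'c \<Rightarrow> 'a \<times> 'b"
  assumes H: "pair_graph H"
    and M: "\<And>a. a \<in> pverts H \<Longrightarrow> pair_graph (M a)"
    and root: "\<And>a. a \<in> pverts H \<Longrightarrow> w a \<in> pverts (M a)"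
    and G: "pair_graph G"
    and \<kappa>: "bij_betw \<kappa> (pverts G) (SIGMA a : pverts H. pverts (M a))"
    and arcs_iff: "\<And>x y. \<lbrakk>x \<in> pverts G; y \<in> pverts G\<rbrakk> \<Longrightarrow> (x, y) \<in> parcs G \<longleftrightarrow>
      (\<kappa> x, \<kappa> y) \<in> rooted_arcs (pverts H) (parcs H) (\<lambda>a. parcs (M a)) w"
begin

abbreviation "V \<equiv> SIGMA a : pverts H. pverts (M a)"

abbreviation "E \<equiv> rooted_arcs (pverts H) (parcs H) (\<lambda>a. parcs (M a)) w"

lemma H_arcs: "parcs H \<subseteq> pverts H \<times> pverts H" "(a, a) \<notin> parcs H"
  using H by (auto simp: pair_graph_iff)

lemma G_arcs: "(x, y) \<in> parcs G \<Longrightarrow> x \<in> pverts G \<and> y \<in> pverts G \<and> (\<kappa> x, \<kappa> y) \<in> E"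
  using G arcs_iff by (auto simp: pair_graph_iff)

lemma ranks_G:
  assumes "ranks k V E' D' g"
    and "\<And>x y. (x, y) \<in> A \<Longrightarrow> (\<kappa> x, \<kappa> y) \<in> E'"
    and "\<And>x y. (x, y) \<in> D \<Longrightarrow> (\<kappa> x, \<kappa> y) \<in> D'"
    and "\<And>x y. \<lbrakk>x \<in> pverts G; y \<in> pverts G; (\<kappa> x, \<kappa> y) \<in> D'\<rbrakk> \<Longrightarrow> (x, y) \<in> D"
  shows "ranks k (pverts G) A D (\<lambda>x. g (\<kappa> x))"
  by (rule ranks_pullback[OF assms(1) bij_betw_imp_inj_on[OF \<kappa>]])
    (use assms(2-4) bij_betwE[OF \<kappa>] in auto)

lemma card_verts: "card (pverts G) = (\<Sum>a \<in> pverts H. card (pverts (M a)))"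
  using bij_betw_same_card[OF \<kappa>] H M by (simp add: pair_graph_iff card_SigmaI)

lemma tree_depth_ge:
  assumes s: "tree_depth H = Suc s"
    and crit: "\<And>a. a \<in> pverts H \<Longrightarrow> critical (Suc r) (M a)"
  shows "r + Suc s \<le> tree_depth G"
proof -
  define \<phi> where "\<phi> = inv_into (pverts G) \<kappa>"
  have inj: "inj_on \<phi> V" and \<phi>: "\<And>p. p \<in> V \<Longrightarrow> \<phi> p \<in> pverts G \<and> \<kappa> (\<phi> p) = p"
    using \<kappa> by (auto simp: \<phi>_def bij_betw_def intro: inv_into_into f_inv_into_f inj_on_inv_into)
  have E: "p \<in> V \<and> q \<in> V" if "(p, q) \<in> E" for p q
    using that H_arcs M root by (fastforce simp: rooted_arcs_def pair_graph_iff)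
  obtain f where f: "ranks (tree_depth G) (pverts G) (parcs G) {} f"
    using tree_depth_le_iff[OF G] by blast
  have "ranks (tree_depth G) V E {} (\<lambda>p. f (\<phi> p))"
    by (rule ranks_pullback[OF f inj]) (use \<phi> E arcs_iff in auto)
  then have "\<exists>h. ranks (tree_depth G - r) (pverts H) (parcs H) {} h"
  proof (rule ranks_rooted_bound)
    show "\<not> ranks r (pverts (M a)) (parcs (M a)) {} f" if "a \<in> pverts H" for a f
      using crit[OF that] tree_depth_le_iff[OF M[OF that], of r] by (auto simp: critical_def)
    show "(x, y) \<in> (parcs (M a))\<^sup>*"
      if "a \<in> pverts H" "x \<in> pverts (M a)" "y \<in> pverts (M a)" for a x y
      using that crit M by (blast intro: critical_connected)
  qed (use M root H_arcs in \<open>auto simp: pair_graph_iff\<close>)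
  then have "Suc s \<le> tree_depth G - r" using tree_depth_le_iff[OF H] s by auto
  then show ?thesis by simp
qed

end

locale rooted_product_unique = rooted_product +
  fixes r s :: nat
  assumes H_crit: "critical (Suc s) H" and H_unique: "one_unique H"
    and M_crit: "\<And>a. a \<in> pverts H \<Longrightarrow> critical (Suc r) (M a)"
    and M_unique: "\<And>a. a \<in> pverts H \<Longrightarrow> one_unique (M a)"
begin

lemma H_label:
  assumes "a \<in> pverts H"
  obtains h where "ranks (Suc s) (pverts H) (parcs H) {} h"
    and "\<And>x. x \<in> pverts H \<Longrightarrow> h x = 1 \<longleftrightarrow> x = a"
  using assms H_unique H_crit unfolding one_unique_iff[OF H] critical_def by metis

lemma M_label:
  assumes "a \<in> pverts H" "z \<in> pverts (M a)"
  obtains f where "ranks (Suc r) (pverts (M a)) (parcs (M a)) {} f"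
    and "\<And>x. x \<in> pverts (M a) \<Longrightarrow> f x = 1 \<longleftrightarrow> x = z"
  using assms M_unique[OF assms(1)] M_crit[OF assms(1)]
  unfolding one_unique_iff[OF M[OF assms(1)]] critical_def by metis

definition bag_label :: "'a \<Rightarrow> 'b \<Rightarrow> nat" where
  "bag_label a = (SOME f. ranks (Suc r) (pverts (M a)) (parcs (M a)) {} f \<and>
                  (\<forall>x \<in> pverts (M a). f x = 1 \<longleftrightarrow> x = w a))"

lemma bag_label:
  assumes "a \<in> pverts H"
  shows "ranks (Suc r) (pverts (M a)) (parcs (M a)) {} (bag_label a)"
    and "x \<in> pverts (M a) \<Longrightarrow> bag_label a x = 1 \<longleftrightarrow> x = w a"
proof -
  have "\<exists>f. ranks (Suc r) (pverts (M a)) (parcs (M a)) {} f \<and>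
      (\<forall>x \<in> pverts (M a). f x = 1 \<longleftrightarrow> x = w a)"
    using M_label[OF assms root[OF assms]] by metis
  from someI_ex[OF this] show "ranks (Suc r) (pverts (M a)) (parcs (M a)) {} (bag_label a)"
    and "x \<in> pverts (M a) \<Longrightarrow> bag_label a x = 1 \<longleftrightarrow> x = w a"
    unfolding bag_label_def by blast+
qed

lemma bag_label_above:
  assumes "a \<in> pverts H"
  shows "ranks r (pverts (M a) - {w a}) (Restr (parcs (M a)) (- {w a})) {} (\<lambda>x. bag_label a x - 1)"
  using bag_label[OF assms] by (intro ranks_remove_lowest) auto

text \<open>
  A saving in the core: all bags are labelled with their roots lowest, the roots are removed with
  their label 1, and every root receives its core label above the \<open>r\<close> labels of the bags. The sets
  \<open>E'\<close> and \<open>D'\<close> cover both the deletion and the contraction of an edge of the core.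
\<close>

lemma ranks_core:
  assumes h: "ranks s (pverts H) E' D' h" and E': "E' \<subseteq> parcs H" and D': "D' \<subseteq> pverts H \<times> pverts H"
  shows "\<exists>g. ranks (r + s) V (rooted_arcs (pverts H) E' (\<lambda>a. parcs (M a)) w)
               (rooted_arcs (pverts H) D' (\<lambda>_. {}) w) g"
proof (rule exI, rule ranks_rooted[OF h, where t = r and c = r])
  show "ranks r (pverts (M a)) (parcs (M a)) {} (\<lambda>x. bag_label a x - 1)"
    if "a \<in> pverts H" "h a + r \<le> r" for a
    using ranksD(1)[OF h that(1)] that by simp
  fix a b assume "(a, b) \<in> D'"
  then show "r < h a + r" using ranksD(1)[OF h, of a] D' by auto
qed (use E' H_arcs bag_label_above in auto)

text \<open>
  A saving in one bag: it is labelled with \<open>r\<close> labels as a whole, so its root needs no label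
  above \<open>r\<close>. Hence the core is ranked with \<open>a\<^sub>0\<close> as its only vertex of label 1, and the
  remaining \<open>s\<close> core labels suffice for the other roots.
\<close>

lemma ranks_bag:
  assumes a0: "a\<^sub>0 \<in> pverts H" and f: "ranks r (pverts (M a\<^sub>0)) F D f"
  shows "\<exists>g. ranks (r + s) V
      (rooted_arcs (pverts H) (parcs H) ((\<lambda>a. parcs (M a))(a\<^sub>0 := F)) w)
      (rooted_arcs (pverts H) {} ((\<lambda>_. {})(a\<^sub>0 := D)) w) g"
proof -
  obtain h where h: "ranks (Suc s) (pverts H) (parcs H) {} h"
    and h1: "\<And>a. a \<in> pverts H \<Longrightarrow> h a = 1 \<longleftrightarrow> a = a\<^sub>0"
    by (rule H_label[OF a0]) blast
  \<comment> \<open>The bag has a vertex, so it cannot be ranked with no label at all; thus \<open>r - 1\<close> is exact.\<close>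
  have r: "1 \<le> r" using ranksD(1,2)[OF f root[OF a0]] by simp
  have low: "h a + (r - 1) \<le> r \<longleftrightarrow> a = a\<^sub>0" if "a \<in> pverts H" for a
    using h1[OF that] ranksD(1)[OF h that] r by auto
  have "ranks (r + s) V
      (rooted_arcs (pverts H) (parcs H) ((\<lambda>a. parcs (M a))(a\<^sub>0 := F)) w)
      (rooted_arcs (pverts H) {} ((\<lambda>_. {})(a\<^sub>0 := D)) w)
      (rooted_label r (r - 1) w h ((\<lambda>a x. bag_label a x - 1)(a\<^sub>0 := f)))"
  proof (rule ranks_rooted[OF h])
    fix a assume a: "a \<in> pverts H"
    show "ranks r (pverts (M a)) (((\<lambda>a. parcs (M a))(a\<^sub>0 := F)) a) (((\<lambda>_. {})(a\<^sub>0 := D)) a)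
        (((\<lambda>a x. bag_label a x - 1)(a\<^sub>0 := f)) a)" if "h a + (r - 1) \<le> r"
      using that low[OF a] f by simp
    show "ranks r (pverts (M a) - {w a}) (Restr (((\<lambda>a. parcs (M a))(a\<^sub>0 := F)) a) (- {w a})) {}
        (((\<lambda>a x. bag_label a x - 1)(a\<^sub>0 := f)) a) \<and> ((\<lambda>_. {})(a\<^sub>0 := D)) a = {}" if "r < h a + (r - 1)"
    proof -
      have "a \<noteq> a\<^sub>0" using that low[OF a] by auto
      then show ?thesis using bag_label_above[OF a] by simp
    qed
  qed (use H_arcs r in auto)
  then show ?thesis by blast
qed

text \<open>
  The bag that contains the chosen vertex keeps all of its \<open>r + 1\<close> labels, with 1 only at
  that vertex, and the core label 1 is spent on this bag. In the other bags the label 1 belonged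
  to the root alone, and the root gets a core label instead, so no further 1 remains.
\<close>

lemma ranks_unique:
  assumes a0: "a\<^sub>0 \<in> pverts H" and z: "z \<in> pverts (M a\<^sub>0)"
  shows "\<exists>g. ranks (r + Suc s) V E {} g \<and> (\<forall>p \<in> V. g p = 1 \<longleftrightarrow> p = (a\<^sub>0, z))"
proof -
  obtain h where h: "ranks (Suc s) (pverts H) (parcs H) {} h"
    and h1: "\<And>a. a \<in> pverts H \<Longrightarrow> h a = 1 \<longleftrightarrow> a = a\<^sub>0"
    by (rule H_label[OF a0]) blast
  obtain f where f: "ranks (Suc r) (pverts (M a\<^sub>0)) (parcs (M a\<^sub>0)) {} f"
    and f1: "\<And>x. x \<in> pverts (M a\<^sub>0) \<Longrightarrow> f x = 1 \<longleftrightarrow> x = z"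
    by (rule M_label[OF a0 z]) blast
  have low: "h a + r \<le> Suc r \<longleftrightarrow> a = a\<^sub>0" if "a \<in> pverts H" for a
    using h1[OF that] ranksD(1)[OF h that] by auto
  define g where "g = rooted_label (Suc r) r w h (bag_label(a\<^sub>0 := f))"
  have "ranks (r + Suc s) V E (rooted_arcs (pverts H) {} (\<lambda>_. {}) w) g"
    unfolding g_def
  proof (rule ranks_rooted[OF h])
    fix a assume a: "a \<in> pverts H"
    show "ranks (Suc r) (pverts (M a)) (parcs (M a)) {} ((bag_label(a\<^sub>0 := f)) a)" if "h a + r \<le> Suc r"
      using that low[OF a] f by simp
    show "ranks (Suc r) (pverts (M a) - {w a}) (Restr (parcs (M a)) (- {w a})) {}
        ((bag_label(a\<^sub>0 := f)) a) \<and> {} = {}" if "Suc r < h a + r"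
    proof -
      have "a \<noteq> a\<^sub>0" using that low[OF a] by auto
      moreover have "ranks (Suc r) (pverts (M a) - {w a}) (Restr (parcs (M a)) (- {w a})) {} (bag_label a)"
        by (rule ranks_subgraph[OF bag_label(1)[OF a]]) auto
      ultimately show ?thesis by simp
    qed
  qed (use H_arcs in auto)
  moreover have "rooted_arcs (pverts H) {} (\<lambda>_. {}) w = {}" by (simp add: rooted_arcs_def)
  moreover have "g (a, x) = 1 \<longleftrightarrow> (a, x) = (a\<^sub>0, z)" if a: "a \<in> pverts H" "x \<in> pverts (M a)" for a x
  proof (cases "a = a\<^sub>0")
    case True
    then show ?thesis using low[OF a(1)] f1 a by (simp add: g_def rooted_label_def)
  next
    case False
    then show ?thesis using low[OF a(1)] bag_label(2)[OF a] by (auto simp: g_def rooted_label_def)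
  qed
  ultimately show ?thesis by auto
qed

lemma tree_depth_eq: "tree_depth G = r + Suc s"
proof (rule antisym)
  have "pverts H \<noteq> {}"
  proof
    assume "pverts H = {}"
    then have "ranks 0 (pverts H) (parcs H) {} (\<lambda>_. 0)" by (simp add: ranks_def)
    then have "tree_depth H \<le> 0" using tree_depth_le_iff[OF H] by blast
    then show False using H_crit by (simp add: critical_def)
  qed
  then obtain a where a: "a \<in> pverts H" by blast
  obtain g where "ranks (r + Suc s) V E {} g" using ranks_unique[OF a root[OF a]] by blast
  then have "ranks (r + Suc s) (pverts G) (parcs G) {} (\<lambda>x. g (\<kappa> x))"
    by (rule ranks_G) (use G_arcs in auto)
  then show "tree_depth G \<le> r + Suc s" using tree_depth_le_iff[OF G] by blast
  show "r + Suc s \<le> tree_depth G"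
    using H_crit M_crit by (intro tree_depth_ge) (auto simp: critical_def)
qed

theorem one_unique_rooted_product: "one_unique G"
  unfolding one_unique_iff[OF G] tree_depth_eq
proof
  fix z assume z: "z \<in> pverts G"
  obtain a x where ax: "\<kappa> z = (a, x)" by fastforce
  then have "a \<in> pverts H" "x \<in> pverts (M a)" using bij_betwE[OF \<kappa>] z by fastforce+
  then obtain g where g: "ranks (r + Suc s) V E {} g" "\<forall>p \<in> V. g p = 1 \<longleftrightarrow> p = (a, x)"
    using ranks_unique by blast
  have "ranks (r + Suc s) (pverts G) (parcs G) {} (\<lambda>y. g (\<kappa> y))"
    by (rule ranks_G[OF g(1)]) (use G_arcs in auto)
  moreover have "g (\<kappa> y) = 1 \<longleftrightarrow> y = z" if "y \<in> pverts G" for y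
    using g(2) bij_betwE[OF \<kappa>] that z ax inj_onD[OF bij_betw_imp_inj_on[OF \<kappa>], of y z]
    by metis
  ultimately show "\<exists>f. ranks (r + Suc s) (pverts G) (parcs G) {} f \<and>
      (\<forall>y \<in> pverts G. f y = 1 \<longleftrightarrow> y = z)" by blast
qed

text \<open>
  Every edge of the rooted product lies in the core or in a single bag, and criticality of that
  part provides the saving of one label, whether the edge is deleted or contracted.
\<close>

lemma ranks_edge_reduction:
  assumes e: "(p, q) \<in> E"
  shows "\<exists>g. ranks (r + s) V (E - edge p q) {} g" and "\<exists>g. ranks (r + s) V E (edge p q) g"
proof -
  consider (core) a b where "(a, b) \<in> parcs H" "p = (a, w a)" "q = (b, w b)"
    | (bag) a x y where "a \<in> pverts H" "(x, y) \<in> parcs (M a)" "p = (a, x)" "q = (a, y)"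
    using e by (auto simp: rooted_arcs_def)
  then have "(\<exists>g. ranks (r + s) V (E - edge p q) {} g) \<and> (\<exists>g. ranks (r + s) V E (edge p q) g)"
  proof cases
    case (core a b)
    obtain h where h: "ranks s (pverts H) (parcs H - edge a b) {} h"
      using H_crit core(1) unfolding critical_Suc_iff[OF H] by blast
    obtain h' where h': "ranks s (pverts H) (parcs H) (edge a b) h'"
      using H_crit core(1) unfolding critical_Suc_iff[OF H] by blast
    have ab: "edge a b \<subseteq> pverts H \<times> pverts H" using core(1) H_arcs by auto
    have D: "rooted_arcs (pverts H) {} (\<lambda>_. {}) w = {}"
      "rooted_arcs (pverts H) (edge a b) (\<lambda>_. {}) w = edge p q"
      and sub: "E - edge p q \<subseteq> rooted_arcs (pverts H) (parcs H - edge a b) (\<lambda>a. parcs (M a)) w"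
      using core by (auto simp: rooted_arcs_def)
    obtain g where "ranks (r + s) V
        (rooted_arcs (pverts H) (parcs H - edge a b) (\<lambda>a. parcs (M a)) w) {} g"
      using ranks_core[OF h Diff_subset empty_subsetI] unfolding D by blast
    then have "ranks (r + s) V (E - edge p q) {} g" by (rule ranks_subgraph[OF _ subset_refl sub])
    moreover have "\<exists>g. ranks (r + s) V E (edge p q) g"
      using ranks_core[OF h' subset_refl ab] unfolding D .
    ultimately show ?thesis by blast
  next
    case (bag a x y)
    note M_a = critical_Suc_iff[OF M[OF bag(1)]]
    obtain f where f: "ranks r (pverts (M a)) (parcs (M a) - edge x y) {} f"
      using M_crit[OF bag(1)] bag(2) unfolding M_a by blast
    obtain f' where f': "ranks r (pverts (M a)) (parcs (M a)) (edge x y) f'"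
      using M_crit[OF bag(1)] bag(2) unfolding M_a by blast
    have D: "rooted_arcs (pverts H) {} ((\<lambda>_. {})(a := {})) w = {}"
      "rooted_arcs (pverts H) {} ((\<lambda>_. {})(a := edge x y)) w = edge p q"
      "(\<lambda>a. parcs (M a))(a := parcs (M a)) = (\<lambda>a. parcs (M a))"
      and sub: "E - edge p q \<subseteq>
        rooted_arcs (pverts H) (parcs H) ((\<lambda>a. parcs (M a))(a := parcs (M a) - edge x y)) w"
      using bag by (auto simp: rooted_arcs_def split: if_splits)
    obtain g where "ranks (r + s) V
        (rooted_arcs (pverts H) (parcs H) ((\<lambda>a. parcs (M a))(a := parcs (M a) - edge x y)) w) {} g"
      using ranks_bag[OF bag(1) f] unfolding D by blast
    then have "ranks (r + s) V (E - edge p q) {} g" by (rule ranks_subgraph[OF _ subset_refl sub])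
    moreover have "\<exists>g. ranks (r + s) V E (edge p q) g"
      using ranks_bag[OF bag(1) f'] unfolding D .
    ultimately show ?thesis by blast
  qed
  then show "\<exists>g. ranks (r + s) V (E - edge p q) {} g" and "\<exists>g. ranks (r + s) V E (edge p q) g"
    by blast+
qed

theorem critical_rooted_product: "critical (r + Suc s) G"
proof -
  have "critical (Suc (r + s)) G"
    unfolding critical_Suc_iff[OF G]
  proof (intro conjI ballI allI impI)
    show "tree_depth G = Suc (r + s)" by (simp add: tree_depth_eq)
    fix z assume "z \<in> pverts G"
    then obtain f where "ranks (Suc (r + s)) (pverts G) (parcs G) {} f"
      "\<forall>x \<in> pverts G. f x = 1 \<longleftrightarrow> x = z"
      using one_unique_rooted_product unfolding one_unique_iff[OF G] tree_depth_eq by auto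
    then have "ranks (r + s) (pverts G - {z}) (Restr (parcs G) (- {z})) {} (\<lambda>x. f x - 1)"
      by (intro ranks_remove_lowest) auto
    then show "\<exists>f. ranks (r + s) (pverts G - {z}) (Restr (parcs G) (- {z})) {} f" by blast
  next
    fix x y assume "(x, y) \<in> parcs G"
    then have xy: "x \<in> pverts G" "y \<in> pverts G" "(\<kappa> x, \<kappa> y) \<in> E" using G_arcs by auto
    have inj: "\<kappa> a = \<kappa> b \<longleftrightarrow> a = b" if "a \<in> pverts G" "b \<in> pverts G" for a b
      using that bij_betw_imp_inj_on[OF \<kappa>] by (simp add: inj_on_eq_iff)
    obtain g where "ranks (r + s) V (E - edge (\<kappa> x) (\<kappa> y)) {} g"
      using ranks_edge_reduction(1)[OF xy(3)] by blast
    then have "ranks (r + s) (pverts G) (parcs G - edge x y) {} (\<lambda>x. g (\<kappa> x))"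
    proof (rule ranks_G)
      fix a b assume "(a, b) \<in> parcs G - edge x y"
      then show "(\<kappa> a, \<kappa> b) \<in> E - edge (\<kappa> x) (\<kappa> y)"
        using G_arcs[of a b] xy(1,2) by (auto simp: inj)
    qed auto
    then show "\<exists>f. ranks (r + s) (pverts G) (parcs G - edge x y) {} f" by blast
    obtain g where "ranks (r + s) V E (edge (\<kappa> x) (\<kappa> y)) g"
      using ranks_edge_reduction(2)[OF xy(3)] by blast
    then have "ranks (r + s) (pverts G) (parcs G) (edge x y) (\<lambda>x. g (\<kappa> x))"
      by (rule ranks_G) (use G_arcs xy(1,2) in \<open>auto simp: inj\<close>)
    then show "\<exists>f. ranks (r + s) (pverts G) (parcs G) (edge x y) f" by blast
  qed
  then show ?thesis by simp
qed

end

section \<open>Gluing as a rooted product\<close>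

lemma pair_graph_disjoint_union:
  assumes "pair_graph H" and "\<And>i. i \<in> {1..q} \<Longrightarrow> pair_graph (L i)"
  shows "pair_graph (disjoint_union H q L)"
proof -
  have "pverts (disjoint_union H q L) = Inl ` pverts H \<union> Inr ` (SIGMA i : {1..q}. pverts (L i))"
    by (auto simp: disjoint_union_def)
  moreover have "finite (SIGMA i : {1..q}. pverts (L i))"
    using assms(2) by (intro finite_SigmaI) (simp_all add: pair_graph_iff)
  ultimately have "finite (pverts (disjoint_union H q L))"
    using assms(1) by (simp add: pair_graph_iff)
  moreover have L: "x \<in> pverts (L i) \<and> y \<in> pverts (L i) \<and> (y, x) \<in> parcs (L i) \<and> x \<noteq> y"
    if "i \<in> {1..q}" "(x, y) \<in> parcs (L i)" for i x y
    using assms(2)[OF that(1)] that(2) by (auto simp: pair_graph_iff dest: symD)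
  have "parcs (disjoint_union H q L) \<subseteq>
      pverts (disjoint_union H q L) \<times> pverts (disjoint_union H q L)"
    using assms(1) L by (auto simp: disjoint_union_def pair_graph_iff)
  moreover have "sym (parcs (disjoint_union H q L))"
    using assms(1) L by (auto simp: disjoint_union_def pair_graph_iff intro!: symI dest: symD)
  moreover have "\<forall>z. (z, z) \<notin> parcs (disjoint_union H q L)"
    using assms(1) L by (auto simp: disjoint_union_def pair_graph_iff)
  ultimately show ?thesis unfolding pair_graph_iff by blast
qed

text \<open>
  A vertex of the core that is produced by identification is the root of its bag, and any
  other vertex \<open>Inr (i, x)\<close> lies in the bag of \<open>v i\<close>.
\<close>

lemma glue_rooted_product:
  assumes H: "pair_graph H" and v: "bij_betw v {1..q} (pverts H)"
    and L: "\<And>i. i \<in> {1..q} \<Longrightarrow> pair_graph (L i)"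
    and w: "\<And>i. i \<in> {1..q} \<Longrightarrow> w i \<in> pverts (L i)"
  shows "rooted_product H (\<lambda>a. L (inv_into {1..q} v a)) (\<lambda>a. w (inv_into {1..q} v a))
    (glue H q v L w)
    (\<lambda>z. case z of Inl a \<Rightarrow> (a, w (inv_into {1..q} v a)) | Inr (i, x) \<Rightarrow> (v i, x))"
    (is "rooted_product H ?M ?w ?G ?\<kappa>")
proof -
  define ix where "ix = inv_into {1..q} v"
  have ix: "ix a \<in> {1..q}" "v (ix a) = a" if "a \<in> pverts H" for a
    using that v inv_into_into[of a v "{1..q}"] f_inv_into_f[of a v "{1..q}"]
    unfolding ix_def bij_betw_def by blast+
  have v: "v i \<in> pverts H" "ix (v i) = i" if "i \<in> {1..q}" for i
    using that v by (auto simp: ix_def bij_betw_def)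
  define \<iota> where "\<iota> i x = (if x = w i then Inl (v i) else Inr (i, x))" for i x
  define c where "c z = (case z of Inl a \<Rightarrow> Inl a | Inr (i, x) \<Rightarrow> \<iota> i x)" for z
  have "c = (\<lambda>z. case z of Inl a \<Rightarrow> Inl a
      | Inr (i, x) \<Rightarrow> if x = w i then Inl (v i) else Inr (i, x))"
    by (auto simp: c_def \<iota>_def fun_eq_iff split: sum.split)
  then have glue: "?G = identify_verts c (disjoint_union H q L)"
    by (simp only: glue_def)
  have c_simps: "c (Inl a) = Inl a" "c (Inr (i, x)) = \<iota> i x" for a i x
    by (simp_all add: c_def)
  have \<iota>_eq: "\<iota> i x = \<iota> i y \<longleftrightarrow> x = y" for i x y by (simp add: \<iota>_def)
  have \<kappa>_\<iota>: "?\<kappa> (\<iota> i x) = (v i, x)" if "i \<in> {1..q}" for i x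
    using v(2)[OF that] by (simp add: \<iota>_def ix_def)
  have verts: "pverts ?G = Inl ` pverts H \<union> {\<iota> i x | i x. i \<in> {1..q} \<and> x \<in> pverts (L i)}"
    unfolding glue identify_verts_def disjoint_union_def
    by (force simp: c_simps image_Un image_iff)
  have arcs: "(z, z') \<in> parcs ?G \<longleftrightarrow>
      (\<exists>a b. z = Inl a \<and> z' = Inl b \<and> (a, b) \<in> parcs H) \<or>
      (\<exists>i x y. z = \<iota> i x \<and> z' = \<iota> i y \<and> i \<in> {1..q} \<and> (x, y) \<in> parcs (L i))"
    (is "_ \<longleftrightarrow> ?A z z'") for z z'
  proof
    assume "(z, z') \<in> parcs ?G"
    then obtain y y' where "z = c y" "z' = c y'" "(y, y') \<in> parcs (disjoint_union H q L)"
      by (auto simp: glue identify_verts_def)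
    then show "?A z z'" by (auto simp: disjoint_union_def c_simps)
  next
    assume A: "?A z z'"
    then have "z \<noteq> z'" using H L by (auto simp: pair_graph_iff \<iota>_eq)
    moreover have "\<exists>y y'. z = c y \<and> z' = c y' \<and> (y, y') \<in> parcs (disjoint_union H q L)"
      using A
    proof (elim disjE exE conjE)
      fix a b assume "z = Inl a" "z' = Inl b" "(a, b) \<in> parcs H"
      then show ?thesis
        by (intro exI[of _ "Inl a"] exI[of _ "Inl b"]) (simp add: disjoint_union_def c_simps)
    next
      fix i x y assume "z = \<iota> i x" "z' = \<iota> i y" "i \<in> {1..q}" "(x, y) \<in> parcs (L i)"
      then show ?thesis
        by (intro exI[of _ "Inr (i, x)"] exI[of _ "Inr (i, y)"])
          (simp add: disjoint_union_def c_simps)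
    qed
    ultimately show "(z, z') \<in> parcs ?G"
      unfolding glue identify_verts_def by (auto intro: map_prod_imageI)
  qed
  \<comment> \<open>The inverse of the isomorphism.\<close>
  define \<psi> where "\<psi> = (\<lambda>(a, x). \<iota> (ix a) x)"
  have Inl: "Inl a = \<psi> (a, ?w a)" if "a \<in> pverts H" for a
    using ix[OF that] by (simp add: \<psi>_def \<iota>_def ix_def)
  have \<psi>_\<kappa>: "\<psi> (?\<kappa> z) = z" "?\<kappa> z \<in> (SIGMA a : pverts H. pverts (?M a))" if "z \<in> pverts ?G" for z
  proof -
    have "\<psi> (?\<kappa> z) = z \<and> ?\<kappa> z \<in> (SIGMA a : pverts H. pverts (?M a))"
      using that unfolding verts
    proof (elim UnE imageE CollectE exE conjE)
      fix a assume a: "z = Inl a" "a \<in> pverts H"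
      then show ?thesis using Inl[OF a(2), symmetric] w[OF ix(1)[OF a(2)]] by (simp add: ix_def)
    next
      fix i x assume ix': "z = \<iota> i x" "i \<in> {1..q}" "x \<in> pverts (L i)"
      then show ?thesis using \<kappa>_\<iota>[of i x] v by (simp add: \<psi>_def ix_def)
    qed
    then show "\<psi> (?\<kappa> z) = z" "?\<kappa> z \<in> (SIGMA a : pverts H. pverts (?M a))" by auto
  qed
  have \<kappa>_\<psi>: "?\<kappa> (\<psi> p) = p" "\<psi> p \<in> pverts ?G" if mem: "p \<in> (SIGMA a : pverts H. pverts (?M a))" for p
  proof -
    obtain a x where p: "p = (a, x)" "a \<in> pverts H" "x \<in> pverts (L (ix a))"
      using mem by (auto simp: ix_def)
    show "?\<kappa> (\<psi> p) = p" using \<kappa>_\<iota>[OF ix(1)[OF p(2)]] ix(2)[OF p(2)] by (simp add: \<psi>_def p(1))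
    show "\<psi> p \<in> pverts ?G" using ix(1)[OF p(2)] p(3) unfolding verts by (auto simp: \<psi>_def p(1))
  qed
  show ?thesis
  proof (rule rooted_product.intro)
    show "pair_graph ?G"
      unfolding glue by (intro pair_graph_identify_verts pair_graph_disjoint_union H L)
    show "bij_betw ?\<kappa> (pverts ?G) (SIGMA a : pverts H. pverts (?M a))"
      using \<psi>_\<kappa> \<kappa>_\<psi> by (intro bij_betw_byWitness[where f' = \<psi>]) blast+
    show "pair_graph (?M a)" "?w a \<in> pverts (?M a)" if "a \<in> pverts H" for a
      using L w ix[OF that] by (simp_all add: ix_def)
    fix z z' assume zz': "z \<in> pverts ?G" "z' \<in> pverts ?G"
    let ?E = "rooted_arcs (pverts H) (parcs H) (\<lambda>a. parcs (?M a)) ?w"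
    show "(z, z') \<in> parcs ?G \<longleftrightarrow> (?\<kappa> z, ?\<kappa> z') \<in> ?E"
    proof
      assume "(z, z') \<in> parcs ?G"
      then show "(?\<kappa> z, ?\<kappa> z') \<in> ?E"
        unfolding arcs
      proof (elim disjE exE conjE)
        fix i x y assume i: "z = \<iota> i x" "z' = \<iota> i y" "i \<in> {1..q}" "(x, y) \<in> parcs (L i)"
        then show ?thesis
          using v[OF i(3)] unfolding i(1,2) \<kappa>_\<iota>[OF i(3)] by (auto simp: rooted_arcs_def ix_def)
      qed (auto simp: rooted_arcs_def)
    next
      assume "(?\<kappa> z, ?\<kappa> z') \<in> ?E"
      then consider a b where "(a, b) \<in> parcs H" "?\<kappa> z = (a, ?w a)" "?\<kappa> z' = (b, ?w b)"
        | a x y where "a \<in> pverts H" "(x, y) \<in> parcs (?M a)" "?\<kappa> z = (a, x)" "?\<kappa> z' = (a, y)"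
        unfolding rooted_arcs_def by blast
      then have "(\<psi> (?\<kappa> z), \<psi> (?\<kappa> z')) \<in> parcs ?G"
      proof cases
        case (1 a b)
        then have "a \<in> pverts H" "b \<in> pverts H" using H by (auto simp: pair_graph_iff)
        moreover have "(Inl a, Inl b) \<in> parcs ?G" using 1(1) unfolding arcs by blast
        ultimately show ?thesis by (simp only: 1(2,3) Inl[symmetric])
      next
        case (2 a x y)
        then show ?thesis
          unfolding 2(3,4) arcs using ix(1)[OF 2(1)] by (auto simp: \<psi>_def ix_def)
      qed
      then show "(z, z') \<in> parcs ?G" using \<psi>_\<kappa> zz' by simp
    qed
  qed (rule H)
qed

theorem theorem4p2:
  fixes s r q :: nat
    and H :: "'a pair_pre_digraph"
    and L :: "nat \<Rightarrow> 'b pair_pre_digraph"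
    and v :: "nat \<Rightarrow> 'a"
    and w :: "nat \<Rightarrow> 'b"
    and G :: "('a + nat \<times> 'b) pair_pre_digraph"
  assumes "s \<ge> 1"
    and "pair_graph H" and "critical s H"
    and "bij_betw v {1..q} (pverts H)"
    and "\<And>i. i \<in> {1..q} \<Longrightarrow> pair_graph (L i)"
    and "\<And>i. i \<in> {1..q} \<Longrightarrow> critical (r + 1) (L i)"
    and "\<And>i. i \<in> {1..q} \<Longrightarrow> w i \<in> pverts (L i)"
    and "G = glue H q v L w"
  shows "(one_unique H \<and> (\<forall>i \<in> {1..q}. one_unique (L i)) \<longrightarrow>
            one_unique G \<and> critical (r + s) G) \<and>
         (card (pverts H) \<le> 2 ^ (tree_depth H - 1) \<and>
          (\<forall>i \<in> {1..q}. card (pverts (L i)) \<le> 2 ^ (tree_depth (L i) - 1)) \<longrightarrow>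
            card (pverts G) \<le> 2 ^ (tree_depth G - 1))"
proof -
  obtain s' where s: "s = Suc s'" using assms(1) by (cases s) auto
  define ix where "ix = inv_into {1..q} v"
  have ix: "ix a \<in> {1..q}" if "a \<in> pverts H" for a
    using that assms(4) inv_into_into[of a v "{1..q}"] unfolding ix_def bij_betw_def by blast
  define \<kappa> :: "'a + nat \<times> 'b \<Rightarrow> 'a \<times> 'b" where
    "\<kappa> = (\<lambda>z. case z of Inl a \<Rightarrow> (a, w (ix a)) | Inr (i, x) \<Rightarrow> (v i, x))"
  interpret rooted_product H "\<lambda>a. L (ix a)" "\<lambda>a. w (ix a)" G \<kappa>
    unfolding ix_def \<kappa>_def assms(8) by (rule glue_rooted_product) (use assms in auto)
  have crit: "critical (Suc r) (L (ix a))" if "a \<in> pverts H" for a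
    using assms(6)[OF ix[OF that]] by simp
  show ?thesis
  proof (intro conjI impI)
    assume unique: "one_unique H \<and> (\<forall>i \<in> {1..q}. one_unique (L i))"
    then interpret rooted_product_unique H "\<lambda>a. L (ix a)" "\<lambda>a. w (ix a)" G \<kappa> r s'
      by unfold_locales (use assms(3) s crit ix in auto)
    show "one_unique G" by (rule one_unique_rooted_product)
    show "critical (r + s) G" unfolding s by (rule critical_rooted_product)
  next
    assume bound: "card (pverts H) \<le> 2 ^ (tree_depth H - 1) \<and>
      (\<forall>i \<in> {1..q}. card (pverts (L i)) \<le> 2 ^ (tree_depth (L i) - 1))"
    have td: "tree_depth H = Suc s'" using assms(3) s by (simp add: critical_def)
    have "card (pverts (L (ix a))) \<le> 2 ^ r" if "a \<in> pverts H" for a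
      using bound ix[OF that] crit[OF that] by (force simp: critical_def)
    then have "card (pverts G) \<le> card (pverts H) * 2 ^ r"
      unfolding card_verts using sum_bounded_above[of "pverts H" _ "2 ^ r :: nat"] by simp
    also have "\<dots> \<le> 2 ^ s' * 2 ^ r" using bound td by simp
    also have "\<dots> = 2 ^ (r + s')" by (simp add: power_add mult.commute)
    also have "\<dots> \<le> 2 ^ (tree_depth G - 1)"
      using tree_depth_ge[OF td crit] by (intro power_increasing) auto
    finally show "card (pverts G) \<le> 2 ^ (tree_depth G - 1)" .
  qed
qed

end
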